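(* Let $AC$ and the 5-quantifier $(\in,=)$-sentence $$AC^{**} \equiv \forall x \exists y \forall z \exists a \forall b\, [(y \in x \wedge A(x,y,z,a)) \vee (y \notin x \wedge B(x,y,z,a,b))]$$ be as defined in the context, where $$A(x,y,z,a) \equiv z \in y \rightarrow (a \in x \wedge a \neq y \wedge z \in a),$$ $$B(x,y,z,a,b) \equiv z \in x \rightarrow \big[(b \in z \rightarrow a \in z \wedge a \in y) \wedge (a \in z \wedge a \in y \rightarrow (b \in z \wedge b \in y \rightarrow b=a))\big].$$ Then $AC^{**}$ is equivalent to the axiom of choice $AC$, in the following sense: $AC^{**} \rightarrow AC$ is provable in first-order predicate calculus with equality alone (no set-theoretic axioms), and $AC \rightarrow AC^{**}$ is provable from the axioms of Extensionality, Pairing, Bounded Separation and Bounded Replacement.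
   Context: The language is first-order predicate calculus with equality and one binary relation symbol $\in$ (models have non-empty domain). All quantifiers range over sets, i.e. over the domain; $z \neq \emptyset$ abbreviates $\exists b\, b \in z$, and $z \cap z' = \emptyset$ abbreviates $\neg\exists a (a \in z \wedge a \in z')$. Choice-set: $C(y,x)$ ("$y$ is a choice-set for $x$") is $$\forall z \in x\, (\exists b\, b \in z \rightarrow \exists a (a \in z \wedge a \in y \wedge \forall b (b \in z \wedge b \in y \rightarrow b = a))).$$ Axiom of choice: $AC \equiv \forall x [AC_{h,1}(x) \wedge AC_{h,2}(x) \rightarrow \exists y\, C(y,x)]$, where $AC_{h,1}(x) \equiv \forall z \in x\; z \neq \emptyset$ and $AC_{h,2}(x) \equiv \forall z, z' \in x\, (z \neq z' \rightarrow z \cap z' = \emptyset)$. Axioms used (the schemes are closed universally over any other parameters; a bounded quantifier is one of the form $\forall u \in v$ or $\exists u \in v$): - Extensionality: $\forall x, y (\forall z (z \in x \leftrightarrow z \in y) \rightarrow x = y)$. - Pairing: $\forall x, y \exists z \forall a (a \in z \leftrightarrow a = x \vee a = y)$. - Bounded Separation: for each formula $\varphi$ in which all quantifiers are bounded and $y$ is not free, $\forall x \exists y \forall z (z \in y \leftrightarrow z \in x \wedge \varphi)$. - Bounded Replacement: for each formula $\phi$ in which all quantifiers are bounded and $y$ is not free, $\forall x (\forall z \exists! z' \phi \rightarrow \exists y \forall z \in x\, \exists z' \in y\; \phi)$. *)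

theory Defs
  imports Main
begin

text \<open>
  First-order formulas over \<open>\<in>\<close> and \<open>=\<close> in de Bruijn notation: the terms of the
  language are variables only, and the variable \<open>n\<close> refers to the \<open>n\<close>-th enclosing quantifier
  counted from the inside, starting at \<open>0\<close> (or to a free variable, if there are too few
  quantifiers). The remaining connectives and \<open>\<exists>\<close> are the usual classical abbreviations.
\<close>

datatype fm =
    Mem nat nat  (infix \<open>\<^bold>\<in>\<close> 62)
  | Equal nat nat  (infix \<open>\<^bold>=\<close> 62)
  | Falsum  (\<open>\<^bold>\<bottom>\<close>)
  | Imp fm fm  (infixr \<open>\<^bold>\<longrightarrow>\<close> 55)
  | Forall fm  (\<open>\<^bold>\<forall>_\<close> [65] 65)

abbreviation Neg :: "fm \<Rightarrow> fm"  (\<open>\<^bold>\<not>_\<close> [65] 65)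
  where "\<^bold>\<not>p \<equiv> p \<^bold>\<longrightarrow> \<^bold>\<bottom>"

abbreviation Con :: "fm \<Rightarrow> fm \<Rightarrow> fm"  (infixr \<open>\<^bold>\<and>\<close> 60)
  where "p \<^bold>\<and> q \<equiv> \<^bold>\<not>(p \<^bold>\<longrightarrow> \<^bold>\<not>q)"

abbreviation Dis :: "fm \<Rightarrow> fm \<Rightarrow> fm"  (infixr \<open>\<^bold>\<or>\<close> 57)
  where "p \<^bold>\<or> q \<equiv> \<^bold>\<not>p \<^bold>\<longrightarrow> q"

abbreviation Iff :: "fm \<Rightarrow> fm \<Rightarrow> fm"  (infix \<open>\<^bold>\<longleftrightarrow>\<close> 53)
  where "p \<^bold>\<longleftrightarrow> q \<equiv> (p \<^bold>\<longrightarrow> q) \<^bold>\<and> (q \<^bold>\<longrightarrow> p)"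

abbreviation Exists :: "fm \<Rightarrow> fm"  (\<open>\<^bold>\<exists>_\<close> [65] 65)
  where "\<^bold>\<exists>p \<equiv> \<^bold>\<not>(\<^bold>\<forall>(\<^bold>\<not>p))"

text \<open>
  Bounded quantifiers. The bound \<open>v\<close> is an index of the context outside the quantifier, hence
  it becomes \<open>Suc v\<close> inside.
\<close>

abbreviation BForall :: "nat \<Rightarrow> fm \<Rightarrow> fm"
  where "BForall v p \<equiv> \<^bold>\<forall>(0 \<^bold>\<in> Suc v \<^bold>\<longrightarrow> p)"

abbreviation BExists :: "nat \<Rightarrow> fm \<Rightarrow> fm"
  where "BExists v p \<equiv> \<^bold>\<exists>(0 \<^bold>\<in> Suc v \<^bold>\<and> p)"

inductive bounded :: "fm \<Rightarrow> bool" where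
  "bounded (m \<^bold>\<in> n)"
| "bounded (m \<^bold>= n)"
| "bounded \<^bold>\<bottom>"
| "bounded p \<Longrightarrow> bounded q \<Longrightarrow> bounded (p \<^bold>\<longrightarrow> q)"
| "bounded p \<Longrightarrow> bounded (BForall v p)"
| "bounded p \<Longrightarrow> bounded (BExists v p)"

primrec free_vars :: "fm \<Rightarrow> nat set" where
  "free_vars (m \<^bold>\<in> n) = {m, n}"
| "free_vars (m \<^bold>= n) = {m, n}"
| "free_vars \<^bold>\<bottom> = {}"
| "free_vars (p \<^bold>\<longrightarrow> q) = free_vars p \<union> free_vars q"
| "free_vars (\<^bold>\<forall>p) = {n. Suc n \<in> free_vars p}"

text \<open>
  Simultaneous (capture-free) substitution of variables for variables; since all terms are
  variables, this is the only substitution needed.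
\<close>

primrec ren :: "(nat \<Rightarrow> nat) \<Rightarrow> fm \<Rightarrow> fm" where
  "ren r (m \<^bold>\<in> n) = (r m \<^bold>\<in> r n)"
| "ren r (m \<^bold>= n) = (r m \<^bold>= r n)"
| "ren r \<^bold>\<bottom> = \<^bold>\<bottom>"
| "ren r (p \<^bold>\<longrightarrow> q) = (ren r p \<^bold>\<longrightarrow> ren r q)"
| "ren r (\<^bold>\<forall>p) = \<^bold>\<forall>(ren (case_nat 0 (\<lambda>n. Suc (r n))) p)"

text \<open>\<open>inst t p\<close> is the matrix \<open>p\<close> of a quantified formula with its outermost variable replaced by \<open>t\<close>.\<close>

definition inst :: "nat \<Rightarrow> fm \<Rightarrow> fm"
  where "inst t p = ren (case_nat t (\<lambda>n. n)) p"

text \<open>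
  \<open>skip k p\<close> is \<open>p\<close> moved to a context with one additional variable, which gets the index
  \<open>k\<close> and is not free in \<open>skip k p\<close>.
\<close>

definition skip :: "nat \<Rightarrow> fm \<Rightarrow> fm"
  where "skip k p = ren (\<lambda>n. if n < k then n else Suc n) p"

text \<open>
  Classical natural deduction for first-order logic with equality (with nonempty domains:
  free variables always denote). In the \<open>\<forall>\<close>-introduction rule, shifting the assumptions
  by \<open>Suc\<close> makes the variable \<open>0\<close> of \<open>p\<close> fresh for them.
\<close>

inductive provable :: "fm set \<Rightarrow> fm \<Rightarrow> bool"  (infix \<open>\<turnstile>\<close> 50) where
  Assume: "p \<in> \<Gamma> \<Longrightarrow> \<Gamma> \<turnstile> p"
| ImpI: "insert p \<Gamma> \<turnstile> q \<Longrightarrow> \<Gamma> \<turnstile> (p \<^bold>\<longrightarrow> q)"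
| ImpE: "\<Gamma> \<turnstile> (p \<^bold>\<longrightarrow> q) \<Longrightarrow> \<Gamma> \<turnstile> p \<Longrightarrow> \<Gamma> \<turnstile> q"
| Contradiction: "insert (\<^bold>\<not>p) \<Gamma> \<turnstile> \<^bold>\<bottom> \<Longrightarrow> \<Gamma> \<turnstile> p"
| ForallI: "ren Suc ` \<Gamma> \<turnstile> p \<Longrightarrow> \<Gamma> \<turnstile> (\<^bold>\<forall>p)"
| ForallE: "\<Gamma> \<turnstile> (\<^bold>\<forall>p) \<Longrightarrow> \<Gamma> \<turnstile> inst t p"
| EqualI: "\<Gamma> \<turnstile> (t \<^bold>= t)"
| EqualE: "\<Gamma> \<turnstile> (s \<^bold>= t) \<Longrightarrow> \<Gamma> \<turnstile> inst s p \<Longrightarrow> \<Gamma> \<turnstile> inst t p"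

definition Extensionality :: fm
  where "Extensionality = \<^bold>\<forall>\<^bold>\<forall>(\<^bold>\<forall>(0 \<^bold>\<in> 2 \<^bold>\<longleftrightarrow> 0 \<^bold>\<in> 1) \<^bold>\<longrightarrow> 1 \<^bold>= 0)"

definition Pairing :: fm
  where "Pairing = \<^bold>\<forall>\<^bold>\<forall>\<^bold>\<exists>\<^bold>\<forall>(0 \<^bold>\<in> 1 \<^bold>\<longleftrightarrow> 0 \<^bold>= 3 \<^bold>\<or> 0 \<^bold>= 2)"

text \<open>
  \<open>\<forall>x \<exists>y \<forall>z (z \<in> y \<longleftrightarrow> z \<in> x \<and> \<phi>)\<close>. In \<open>p\<close>, the variables \<open>0\<close> and \<open>1\<close> stand for
  \<open>z\<close> and \<open>x\<close>, the further ones for parameters; \<open>skip\<close> inserts \<open>y\<close>, which is not free in \<open>\<phi>\<close>.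
\<close>

definition Separation :: "fm \<Rightarrow> fm"
  where "Separation p = \<^bold>\<forall>\<^bold>\<exists>\<^bold>\<forall>(0 \<^bold>\<in> 1 \<^bold>\<longleftrightarrow> 0 \<^bold>\<in> 2 \<^bold>\<and> skip 1 p)"

definition Exists1 :: "fm \<Rightarrow> fm"  (\<open>\<^bold>\<exists>!_\<close> [65] 65)
  where "\<^bold>\<exists>!p = \<^bold>\<exists>(p \<^bold>\<and> \<^bold>\<forall>(skip 1 p \<^bold>\<longrightarrow> 0 \<^bold>= 1))"

text \<open>
  \<open>\<forall>x (\<forall>z \<exists>!z' \<phi> \<longrightarrow> \<exists>y \<forall>z \<in> x \<exists>z' \<in> y \<phi>)\<close>. In \<open>p\<close>, the variables \<open>0\<close>, \<open>1\<close> and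
  \<open>2\<close> stand for \<open>z'\<close>, \<open>z\<close> and \<open>x\<close>, the further ones for parameters.
\<close>

definition Replacement :: "fm \<Rightarrow> fm"
  where "Replacement p = \<^bold>\<forall>(\<^bold>\<forall>\<^bold>\<exists>!p \<^bold>\<longrightarrow> \<^bold>\<exists>(BForall 1 (BExists 1 (skip 2 p))))"

text \<open>The prefix may contain vacuous quantifiers.\<close>

definition universal_closures :: "fm \<Rightarrow> fm set"
  where "universal_closures p = {q. (\<exists>n. q = (Forall ^^ n) p) \<and> free_vars q = {}}"

definition set_axioms :: "fm set"
  where "set_axioms = {Extensionality, Pairing}
    \<union> (\<Union>p \<in> {p. bounded p}. universal_closures (Separation p))
    \<union> (\<Union>p \<in> {p. bounded p}. universal_closures (Replacement p))"

text \<open>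
  In the following definitions, the arguments named like the variables of the formula are their
  indices in the context of the formula defined.
\<close>

definition Choice_set :: "nat \<Rightarrow> nat \<Rightarrow> fm"
  where "Choice_set y x = BForall x (\<^bold>\<exists>(0 \<^bold>\<in> 1) \<^bold>\<longrightarrow>
    \<^bold>\<exists>(0 \<^bold>\<in> 1 \<^bold>\<and> 0 \<^bold>\<in> y + 2 \<^bold>\<and> \<^bold>\<forall>(0 \<^bold>\<in> 2 \<^bold>\<and> 0 \<^bold>\<in> y + 3 \<^bold>\<longrightarrow> 0 \<^bold>= 1)))"

definition AC_h1 :: "nat \<Rightarrow> fm"
  where "AC_h1 x = BForall x (\<^bold>\<exists>(0 \<^bold>\<in> 1))"

definition AC_h2 :: "nat \<Rightarrow> fm"
  where "AC_h2 x = BForall x (BForall (x + 1)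
    (\<^bold>\<not>(1 \<^bold>= 0) \<^bold>\<longrightarrow> \<^bold>\<not>(\<^bold>\<exists>(0 \<^bold>\<in> 2 \<^bold>\<and> 0 \<^bold>\<in> 1))))"

definition AC :: fm
  where "AC = \<^bold>\<forall>(AC_h1 0 \<^bold>\<and> AC_h2 0 \<^bold>\<longrightarrow> \<^bold>\<exists>(Choice_set 0 1))"

definition A_fm :: "nat \<Rightarrow> nat \<Rightarrow> nat \<Rightarrow> nat \<Rightarrow> fm"
  where "A_fm x y z a = (z \<^bold>\<in> y \<^bold>\<longrightarrow> a \<^bold>\<in> x \<^bold>\<and> \<^bold>\<not>(a \<^bold>= y) \<^bold>\<and> z \<^bold>\<in> a)"

definition B_fm :: "nat \<Rightarrow> nat \<Rightarrow> nat \<Rightarrow> nat \<Rightarrow> nat \<Rightarrow> fm"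
  where "B_fm x y z a b = (z \<^bold>\<in> x \<^bold>\<longrightarrow>
    (b \<^bold>\<in> z \<^bold>\<longrightarrow> a \<^bold>\<in> z \<^bold>\<and> a \<^bold>\<in> y) \<^bold>\<and>
    (a \<^bold>\<in> z \<^bold>\<and> a \<^bold>\<in> y \<^bold>\<longrightarrow> (b \<^bold>\<in> z \<^bold>\<and> b \<^bold>\<in> y \<^bold>\<longrightarrow> b \<^bold>= a)))"

definition AC_ss_matrix :: "nat \<Rightarrow> nat \<Rightarrow> nat \<Rightarrow> nat \<Rightarrow> nat \<Rightarrow> fm"
  where "AC_ss_matrix x y z a b =
    ((y \<^bold>\<in> x \<^bold>\<and> A_fm x y z a) \<^bold>\<or> (\<^bold>\<not>(y \<^bold>\<in> x) \<^bold>\<and> B_fm x y z a b))"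

text \<open>The sentence \<open>AC\<^sup>*\<^sup>*\<close>; its quantifiers bind \<open>x\<close>, \<open>y\<close>, \<open>z\<close>, \<open>a\<close>, \<open>b\<close> in this order.\<close>

definition AC_ss :: fm
  where "AC_ss = \<^bold>\<forall>\<^bold>\<exists>\<^bold>\<forall>\<^bold>\<exists>\<^bold>\<forall>(AC_ss_matrix 4 3 2 1 0)"

end

theory Submission
  imports Defs "HOL-Library.Countable"
begin

text \<open>
  By the completeness theorem for the calculus it suffices to argue in models. In its proof by
  Henkin's method the variables themselves serve as witnesses: only sets of sentences, in which no
  variable is free, need to be extended to maximal consistent sets.

  For \<open>AC\<^sup>*\<^sup>* \<longrightarrow> AC\<close>, let \<open>x\<close> consist of nonempty pairwise disjoint sets and take the \<open>y\<close> given by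
  \<open>AC\<^sup>*\<^sup>*\<close>. If \<open>y \<in> x\<close>, then an element of \<open>y\<close> also lies in another member of \<open>x\<close>, contradicting
  disjointness; so \<open>y \<notin> x\<close>, and then \<open>y\<close> is a choice-set for \<open>x\<close>.

  For \<open>AC \<longrightarrow> AC\<^sup>*\<^sup>*\<close>, let \<open>P z\<close> be the set of those elements of \<open>z\<close> which lie in no other member of
  \<open>x\<close>. If \<open>P y\<close> is empty for some \<open>y \<in> x\<close>, this \<open>y\<close> is as required. Otherwise the sets \<open>P z\<close> with
  \<open>z \<in> x\<close> are nonempty and pairwise disjoint. Restricting a choice-set for them to their union gives
  a set \<open>y\<close> which meets each member of \<open>x\<close> in exactly one point. If \<open>y \<notin> x\<close>, we are done. If
  \<open>y \<in> x\<close>, then \<open>y\<close> is a singleton \<open>{c}\<close> with \<open>c\<close> private to each member of \<open>x\<close>, so \<open>x = {{c}}\<close>, and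
  \<open>{c, d}\<close> with any \<open>d \<noteq> c\<close> serves instead of \<open>y\<close>.
\<close>

section \<open>Renaming\<close>

abbreviation extend :: "'a \<Rightarrow> (nat \<Rightarrow> 'a) \<Rightarrow> nat \<Rightarrow> 'a"  (infixr \<open>##\<close> 65)
  where "x ## e \<equiv> case_nat x e"

lemma extend_comp: "(\<lambda>n. f ((x ## e) n)) = f x ## (\<lambda>n. f (e n))"
  by (simp add: fun_eq_iff split: nat.split)

lemma extend_eta: "e 0 ## (\<lambda>n. e (Suc n)) = e"
  by (simp add: fun_eq_iff split: nat.split)

lemma range_extend: "x \<in> U \<Longrightarrow> range e \<subseteq> U \<Longrightarrow> range (x ## e) \<subseteq> U"
  by (simp add: image_subset_iff split: nat.split)

lemma ren_cong: "(\<And>n. n \<in> free_vars p \<Longrightarrow> r n = s n) \<Longrightarrow> ren r p = ren s p"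
proof (induction p arbitrary: r s)
  case (Forall p)
  have "(0 ## (\<lambda>n. Suc (r n))) n = (0 ## (\<lambda>n. Suc (s n))) n" if "n \<in> free_vars p" for n
    using Forall.prems[of "n - 1"] that by (cases n) simp_all
  then show ?case
    unfolding ren.simps fm.inject by (rule Forall.IH)
next
  case (Imp p q)
  have "ren r p = ren s p" "ren r q = ren s q"
    by (rule Imp.IH, rule Imp.prems, simp)+
  then show ?case by simp
qed simp_all

lemma ren_ident: "ren (\<lambda>n. n) p = p"
proof (induction p)
  case (Forall p)
  have "0 ## Suc = (\<lambda>n. n)"
    by (simp add: fun_eq_iff split: nat.split)
  with Forall show ?case by (simp only: ren.simps)
qed auto

lemma ren_closed: "free_vars p = {} \<Longrightarrow> ren r p = p"
  using ren_cong[of p r "\<lambda>n. n"] by (simp add: ren_ident)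

lemma ren_ren: "ren r (ren s p) = ren (\<lambda>n. r (s n)) p"
proof (induction p arbitrary: r s)
  case (Forall p)
  have "(\<lambda>n. (0 ## (\<lambda>n. Suc (r n))) ((0 ## (\<lambda>n. Suc (s n))) n)) = 0 ## (\<lambda>n. Suc (r (s n)))"
    by (simp add: fun_eq_iff split: nat.split)
  with Forall show ?case by (simp only: ren.simps)
qed auto

lemma ren_inst: "ren r (inst t p) = inst (r t) (ren (0 ## (\<lambda>n. Suc (r n))) p)"
  unfolding inst_def ren_ren by (rule ren_cong) (auto split: nat.split)

text \<open>The quantifier step of \<open>sat_cls_iff\<close>: there renamings play the role of
  assignments, and instantiating with \<open>t\<close> has to become extending the renaming by
  \<open>t\<close>.\<close>

lemma inst_ren_lift: "inst t (ren (0 ## (\<lambda>n. Suc (r n))) p) = ren (t ## r) p"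
  unfolding inst_def ren_ren by (rule ren_cong) (auto split: nat.split)

lemma finite_free_vars: "finite (free_vars p)"
proof (induction p)
  case (Forall p)
  have "{n. Suc n \<in> free_vars p} = Suc -` free_vars p"
    by auto
  with Forall show ?case by (simp add: finite_vimageI)
qed auto

lemma free_vars_Forall_pow: "free_vars ((Forall ^^ n) p) = {m. m + n \<in> free_vars p}"
  by (induction n) auto

lemma ex_universal_closure: "\<exists>n. (Forall ^^ n) p \<in> universal_closures p"
proof -
  obtain n where "\<forall>m\<in>free_vars p. m < n"
    using finite_free_vars[of p] by (auto simp: finite_nat_set_iff_bounded)
  then have "free_vars ((Forall ^^ n) p) = {}"
    unfolding free_vars_Forall_pow by fastforce
  then show ?thesis
    unfolding universal_closures_def by blast
qed

lemma closed_set_axioms: "p \<in> set_axioms \<Longrightarrow> free_vars p = {}"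
  unfolding set_axioms_def universal_closures_def Extensionality_def Pairing_def
  by (auto simp: numeral_eq_Suc)

lemma closed_AC: "free_vars AC = {}"
  by (auto simp: AC_def AC_h1_def AC_h2_def Choice_set_def numeral_eq_Suc)

section \<open>Derivability\<close>

lemma weakening: "\<Gamma> \<turnstile> p \<Longrightarrow> \<Gamma> \<subseteq> \<Delta> \<Longrightarrow> \<Delta> \<turnstile> p"
proof (induction arbitrary: \<Delta> rule: provable.induct)
  case (ImpI p \<Gamma> q)
  then show ?case by (meson insert_mono provable.ImpI)
next
  case (Contradiction p \<Gamma>)
  then show ?case by (meson insert_mono provable.Contradiction)
next
  case (ForallI \<Gamma> p)
  then show ?case by (meson image_mono provable.ForallI)
next
  case (EqualE \<Gamma> s t p)
  then show ?case by (meson provable.EqualE)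
qed (auto intro: provable.intros)

lemma provable_ren: "\<Gamma> \<turnstile> p \<Longrightarrow> ren r ` \<Gamma> \<turnstile> ren r p"
proof (induction arbitrary: r rule: provable.induct)
  case (ForallI \<Gamma> p)
  have "ren (0 ## (\<lambda>n. Suc (r n))) ` ren Suc ` \<Gamma> = ren Suc ` ren r ` \<Gamma>"
    by (simp add: image_image ren_ren)
  with ForallI.IH[of "0 ## (\<lambda>n. Suc (r n))"] show ?case
    by (auto intro: provable.ForallI)
next
  case (ForallE \<Gamma> p t)
  then show ?case by (auto simp: ren_inst intro: provable.ForallE)
next
  case (EqualE \<Gamma> s t p)
  then show ?case by (auto simp: ren_inst intro: provable.EqualE)
next
  case (ImpE \<Gamma> p q)
  then show ?case by (auto intro: provable.ImpE)
qed (auto intro: provable.intros)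

text \<open>\<open>ForallI\<close> generalizes over index 0 only. The renaming \<open>r\<close>
  sends \<open>v\<close> to 0 and shifts every other index: on formulas without \<open>v\<close> it
  is the shift by \<open>Suc\<close>, and it turns \<open>inst v p\<close> back into
  \<open>p\<close>.\<close>

lemma ForallI_fresh:
  assumes "\<Gamma> \<turnstile> inst v p" and "\<And>q. q \<in> \<Gamma> \<Longrightarrow> v \<notin> free_vars q" and "v \<notin> free_vars (\<^bold>\<forall>p)"
  shows "\<Gamma> \<turnstile> (\<^bold>\<forall>p)"
proof -
  define r where "r n = (if n = v then 0 else Suc n)" for n
  have "ren r q = ren Suc q" if "q \<in> \<Gamma>" for q
    by (rule ren_cong) (use assms(2)[OF that] in \<open>auto simp: r_def\<close>)
  then have \<Gamma>: "ren r ` \<Gamma> = ren Suc ` \<Gamma>"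
    by (rule image_cong[OF refl])
  have "ren r (inst v p) = ren (\<lambda>n. n) p"
    unfolding inst_def ren_ren
    by (rule ren_cong) (use assms(3) in \<open>auto simp: r_def split: nat.split\<close>)
  then have "ren r (inst v p) = p"
    by (simp add: ren_ident)
  with provable_ren[OF assms(1), of r] \<Gamma> show ?thesis
    by (auto intro: ForallI)
qed

lemma cut: "insert p \<Gamma> \<turnstile> q \<Longrightarrow> \<Gamma> \<turnstile> p \<Longrightarrow> \<Gamma> \<turnstile> q"
  by (blast intro: ImpI ImpE)

lemma FalsumE: "\<Gamma> \<turnstile> \<^bold>\<bottom> \<Longrightarrow> \<Gamma> \<turnstile> p"
  by (rule Contradiction) (auto elim: weakening)

lemma provable_finite: "\<Gamma> \<turnstile> p \<Longrightarrow> \<exists>\<Delta>\<subseteq>\<Gamma>. finite \<Delta> \<and> \<Delta> \<turnstile> p"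
proof (induction rule: provable.induct)
  case (Assume p \<Gamma>)
  then show ?case by (intro exI[of _ "{p}"]) (auto intro: provable.Assume)
next
  case (ImpI p \<Gamma> q)
  then obtain \<Delta> where "\<Delta> \<subseteq> insert p \<Gamma>" "finite \<Delta>" "\<Delta> \<turnstile> q" by blast
  then show ?case
    \<comment> \<open>\<open>p\<close> is discharged by the rule, so it is removed from the finite
      set to stay within \<open>\<Gamma>\<close>.\<close>
    by (intro exI[of _ "\<Delta> - {p}"] conjI provable.ImpI) (auto elim: weakening)
next
  case (ImpE \<Gamma> p q)
  then obtain \<Delta> \<Delta>' where "\<Delta> \<subseteq> \<Gamma>" "finite \<Delta>" "\<Delta> \<turnstile> (p \<^bold>\<longrightarrow> q)" "\<Delta>' \<subseteq> \<Gamma>" "finite \<Delta>'" "\<Delta>' \<turnstile> p"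
    by blast
  then show ?case
    by (intro exI[of _ "\<Delta> \<union> \<Delta>'"]) (auto intro: provable.ImpE[of _ p] elim: weakening)
next
  case (Contradiction p \<Gamma>)
  then obtain \<Delta> where "\<Delta> \<subseteq> insert (\<^bold>\<not>p) \<Gamma>" "finite \<Delta>" "\<Delta> \<turnstile> \<^bold>\<bottom>" by blast
  then show ?case
    by (intro exI[of _ "\<Delta> - {\<^bold>\<not>p}"] conjI provable.Contradiction[of p])
      (auto elim: weakening)
next
  case (ForallI \<Gamma> p)
  then obtain \<Delta> where "\<Delta> \<subseteq> ren Suc ` \<Gamma>" "finite \<Delta>" "\<Delta> \<turnstile> p" by blast
  then obtain \<Delta>' where "\<Delta>' \<subseteq> \<Gamma>" "finite \<Delta>'" "\<Delta> = ren Suc ` \<Delta>'"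
    by (meson finite_subset_image)
  with \<open>\<Delta> \<turnstile> p\<close> show ?case
    by (blast intro: provable.ForallI)
next
  case (EqualE \<Gamma> s t p)
  then obtain \<Delta> \<Delta>' where "\<Delta> \<subseteq> \<Gamma>" "finite \<Delta>" "\<Delta> \<turnstile> (s \<^bold>= t)" "\<Delta>' \<subseteq> \<Gamma>" "finite \<Delta>'" "\<Delta>' \<turnstile> inst s p"
    by blast
  then show ?case
    by (intro exI[of _ "\<Delta> \<union> \<Delta>'"]) (auto intro: provable.EqualE[of _ s] elim: weakening)
qed (auto intro: provable.intros)

section \<open>Completeness\<close>

text \<open>The domain is a set and not a whole type because the term model below lives on
  \<open>range cls\<close>.\<close>

primrec sat :: "'a set \<Rightarrow> ('a \<Rightarrow> 'a \<Rightarrow> bool) \<Rightarrow> (nat \<Rightarrow> 'a) \<Rightarrow> fm \<Rightarrow> bool" where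
  "sat U E e (m \<^bold>\<in> n) = E (e m) (e n)"
| "sat U E e (m \<^bold>= n) = (e m = e n)"
| "sat U E e \<^bold>\<bottom> = False"
| "sat U E e (p \<^bold>\<longrightarrow> q) = (sat U E e p \<longrightarrow> sat U E e q)"
| "sat U E e (\<^bold>\<forall>p) = (\<forall>x\<in>U. sat U E (x ## e) p)"

definition valid_in :: "'a set \<Rightarrow> ('a \<Rightarrow> 'a \<Rightarrow> bool) \<Rightarrow> fm \<Rightarrow> bool"
  where "valid_in U E p \<longleftrightarrow> (\<forall>e. range e \<subseteq> U \<longrightarrow> sat U E e p)"

lemma sat_ren: "sat U E e (ren r p) = sat U E (\<lambda>n. e (r n)) p"
proof (induction p arbitrary: e r)
  case (Forall p)
  have "(\<lambda>n. (x ## e) ((0 ## (\<lambda>n. Suc (r n))) n)) = x ## (\<lambda>n. e (r n))" for x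
    by (simp add: fun_eq_iff split: nat.split)
  with Forall show ?case by simp
qed auto

section \<open>Henkin extension of a consistent set of formulas\<close>

abbreviation consistent :: "fm set \<Rightarrow> bool"
  where "consistent \<Gamma> \<equiv> \<not> \<Gamma> \<turnstile> \<^bold>\<bottom>"

instance fm :: countable
  by countable_datatype

definition fresh :: "fm set \<Rightarrow> nat"
  where "fresh \<Gamma> = (SOME v. \<forall>q\<in>\<Gamma>. v \<notin> free_vars q)"

definition witness :: "fm set \<Rightarrow> fm \<Rightarrow> fm set"
  where "witness \<Gamma> p = {\<^bold>\<not>(inst (fresh (insert p \<Gamma>)) q) | q. p = \<^bold>\<not>(\<^bold>\<forall>q)}"

text \<open>A formula \<open>p\<close> is examined at stage \<open>to_nat p\<close>. Numbers that
  code no formula merely cause some formula to be examined once more.\<close>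

primrec henkin :: "fm set \<Rightarrow> nat \<Rightarrow> fm set" where
  "henkin \<Gamma> 0 = \<Gamma>"
| "henkin \<Gamma> (Suc n) = (let p = from_nat n in
    if consistent (insert p (henkin \<Gamma> n)) then insert p (henkin \<Gamma> n) \<union> witness (henkin \<Gamma> n) p
    else henkin \<Gamma> n)"

lemma fresh:
  assumes "finite (\<Union> (free_vars ` \<Gamma>))" "q \<in> \<Gamma>"
  shows "fresh \<Gamma> \<notin> free_vars q"
proof -
  have "\<exists>v. v \<notin> \<Union> (free_vars ` \<Gamma>)"
    using assms(1) ex_new_if_finite infinite_UNIV_nat by blast
  then have "\<exists>v. \<forall>q\<in>\<Gamma>. v \<notin> free_vars q"
    by blast
  from someI_ex[OF this] assms(2) show ?thesis
    unfolding fresh_def by blast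
qed

lemma witness_cases: "witness \<Gamma> p = {} \<or> (\<exists>q. p = \<^bold>\<not>(\<^bold>\<forall>q) \<and> witness \<Gamma> p = {\<^bold>\<not>(inst (fresh (insert p \<Gamma>)) q)})"
  unfolding witness_def by blast

text \<open>If the negated instance at the fresh variable were refutable, the instance itself would
  be provable; generalizing over that variable would then contradict \<open>p\<close>.\<close>

lemma consistent_witness:
  assumes "finite (\<Union> (free_vars ` \<Gamma>))" "consistent (insert p \<Gamma>)"
  shows "consistent (insert p \<Gamma> \<union> witness \<Gamma> p)"
  using witness_cases[of \<Gamma> p]
proof
  assume "witness \<Gamma> p = {}"
  with assms(2) show ?thesis by simp
next
  let ?v = "fresh (insert p \<Gamma>)"
  assume "\<exists>q. p = \<^bold>\<not>(\<^bold>\<forall>q) \<and> witness \<Gamma> p = {\<^bold>\<not>(inst ?v q)}"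
  then obtain q where p: "p = \<^bold>\<not>(\<^bold>\<forall>q)" and w: "witness \<Gamma> p = {\<^bold>\<not>(inst ?v q)}"
    by blast
  have v: "?v \<notin> free_vars r" if "r \<in> insert p \<Gamma>" for r
    by (rule fresh[OF _ that]) (simp add: assms(1) finite_free_vars)
  show ?thesis
  proof
    assume "insert p \<Gamma> \<union> witness \<Gamma> p \<turnstile> \<^bold>\<bottom>"
    then have "insert p \<Gamma> \<turnstile> inst ?v q"
      unfolding w by (simp add: Contradiction)
    then have "insert p \<Gamma> \<turnstile> (\<^bold>\<forall>q)"
      using v v[of p] p by (auto intro: ForallI_fresh[of _ ?v])
    moreover have "insert p \<Gamma> \<turnstile> (\<^bold>\<not>(\<^bold>\<forall>q))"
      unfolding p by (rule Assume) simp
    ultimately have "insert p \<Gamma> \<turnstile> \<^bold>\<bottom>"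
      by (blast intro: ImpE)
    with assms(2) show False ..
  qed
qed

lemma finite_witness: "finite (witness \<Gamma> p)"
  using witness_cases[of \<Gamma> p] by (elim disjE exE conjE) simp_all

lemma finite_free_vars_henkin:
  assumes "finite (\<Union> (free_vars ` \<Gamma>))"
  shows "finite (\<Union> (free_vars ` henkin \<Gamma> n))"
proof (induction n)
  case (Suc n)
  then show ?case
    by (simp add: Let_def finite_witness finite_free_vars)
qed (simp add: assms)

lemma consistent_henkin:
  assumes "finite (\<Union> (free_vars ` \<Gamma>))" "consistent \<Gamma>"
  shows "consistent (henkin \<Gamma> n)"
proof (induction n)
  case (Suc n)
  show ?case
  proof (cases "consistent (insert (from_nat n) (henkin \<Gamma> n))")
    case True
    then have "henkin \<Gamma> (Suc n) =
        insert (from_nat n) (henkin \<Gamma> n) \<union> witness (henkin \<Gamma> n) (from_nat n)"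
      by (simp only: henkin.simps Let_def if_True not_False_eq_True)
    with consistent_witness[OF finite_free_vars_henkin[OF assms(1)] True] show ?thesis
      by (simp only: not_False_eq_True)
  next
    case False
    then have "henkin \<Gamma> (Suc n) = henkin \<Gamma> n"
      by (simp only: henkin.simps Let_def if_False)
    with Suc show ?thesis
      by (simp only: not_False_eq_True)
  qed
qed (simp add: assms(2))

lemma henkin_Suc_mono: "henkin \<Gamma> n \<subseteq> henkin \<Gamma> (Suc n)"
  by (auto simp: Let_def)

lemma henkin_mono: "m \<le> n \<Longrightarrow> henkin \<Gamma> m \<subseteq> henkin \<Gamma> n"
  using henkin_Suc_mono by (rule lift_Suc_mono_le)

section \<open>The term model of a Henkin set\<close>

locale henkin_set =
  fixes M :: "fm set"
  assumes consistent: "consistent M"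
    and maximal: "consistent (insert p M) \<Longrightarrow> p \<in> M"
    and witnessed: "\<^bold>\<not>(\<^bold>\<forall>p) \<in> M \<Longrightarrow> \<exists>t. \<^bold>\<not>(inst t p) \<in> M"
begin

lemma mem_iff_provable: "p \<in> M \<longleftrightarrow> M \<turnstile> p"
  using consistent maximal Assume cut by blast

lemma Falsum_notin: "\<^bold>\<bottom> \<notin> M"
  using consistent by (simp add: mem_iff_provable)

lemma Neg_in_iff: "\<^bold>\<not>p \<in> M \<longleftrightarrow> p \<notin> M"
proof
  assume "\<^bold>\<not>p \<in> M"
  then show "p \<notin> M"
    using consistent by (auto simp: mem_iff_provable intro: ImpE)
next
  assume "p \<notin> M"
  then have "insert p M \<turnstile> \<^bold>\<bottom>"
    using maximal by blast
  then show "\<^bold>\<not>p \<in> M"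
    by (simp add: mem_iff_provable ImpI)
qed

lemma Imp_in_iff: "(p \<^bold>\<longrightarrow> q) \<in> M \<longleftrightarrow> (p \<in> M \<longrightarrow> q \<in> M)"
proof
  assume "(p \<^bold>\<longrightarrow> q) \<in> M"
  then show "p \<in> M \<longrightarrow> q \<in> M"
    by (auto simp: mem_iff_provable intro: ImpE)
next
  assume pq: "p \<in> M \<longrightarrow> q \<in> M"
  have "insert p M \<turnstile> q"
  proof (cases "p \<in> M")
    case True
    with pq show ?thesis by (blast intro: Assume)
  next
    case False
    then show ?thesis
      using maximal FalsumE by blast
  qed
  then show "(p \<^bold>\<longrightarrow> q) \<in> M"
    by (simp add: mem_iff_provable ImpI)
qed

lemma Forall_in_iff: "(\<^bold>\<forall>p) \<in> M \<longleftrightarrow> (\<forall>t. inst t p \<in> M)"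
  using witnessed[of p] by (auto simp: Neg_in_iff) (auto simp: mem_iff_provable intro: ForallE)

lemma Equal_refl: "(s \<^bold>= s) \<in> M"
  by (simp add: mem_iff_provable EqualI)

lemma Equal_subst: "(s \<^bold>= t) \<in> M \<Longrightarrow> inst s p \<in> M \<Longrightarrow> inst t p \<in> M"
  unfolding mem_iff_provable by (rule EqualE)

lemma Equal_sym: "(s \<^bold>= t) \<in> M \<Longrightarrow> (t \<^bold>= s) \<in> M"
  \<comment> \<open>\<open>inst\<close> lowers the indices above 0, so \<open>Suc s\<close> becomes
    \<open>s\<close>: the two instances are \<open>s = s\<close> and \<open>t = s\<close>.\<close>
  using Equal_subst[of s t "0 \<^bold>= Suc s"] Equal_refl by (simp add: inst_def)

lemma Equal_trans: "(s \<^bold>= t) \<in> M \<Longrightarrow> (t \<^bold>= u) \<in> M \<Longrightarrow> (s \<^bold>= u) \<in> M"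
  using Equal_subst[of t u "Suc s \<^bold>= 0"] by (simp add: inst_def)

lemma Mem_cong: "(s \<^bold>= s') \<in> M \<Longrightarrow> (t \<^bold>= t') \<in> M \<Longrightarrow> (s \<^bold>\<in> t) \<in> M \<Longrightarrow> (s' \<^bold>\<in> t') \<in> M"
  using Equal_subst[of s s' "0 \<^bold>\<in> Suc t"] Equal_subst[of t t' "Suc s' \<^bold>\<in> 0"]
  by (simp add: inst_def)

definition cls :: "nat \<Rightarrow> nat set"
  where "cls s = {t. (s \<^bold>= t) \<in> M}"

definition cls_mem :: "nat set \<Rightarrow> nat set \<Rightarrow> bool"
  where "cls_mem a b \<longleftrightarrow> (\<exists>s t. a = cls s \<and> b = cls t \<and> (s \<^bold>\<in> t) \<in> M)"

lemma cls_eq_iff: "cls s = cls t \<longleftrightarrow> (s \<^bold>= t) \<in> M"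
  unfolding cls_def using Equal_refl Equal_sym Equal_trans by blast

lemma cls_mem_iff: "cls_mem (cls s) (cls t) \<longleftrightarrow> (s \<^bold>\<in> t) \<in> M"
  unfolding cls_mem_def cls_eq_iff using Mem_cong Equal_sym Equal_refl by blast

text \<open>The truth lemma. It is stated for all \<open>r\<close> because passing under a
  quantifier extends the assignment by an arbitrary class \<open>cls t\<close>, which amounts to
  extending \<open>r\<close> by \<open>t\<close>.\<close>

lemma sat_cls_iff: "sat (range cls) cls_mem (\<lambda>n. cls (r n)) p \<longleftrightarrow> ren r p \<in> M"
proof (induction p arbitrary: r)
  case (Forall p)
  have "sat (range cls) cls_mem (cls t ## (\<lambda>n. cls (r n))) p \<longleftrightarrow> ren (t ## r) p \<in> M" for t
    using Forall[of "t ## r"] by (simp add: extend_comp)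
  then show ?case
    by (simp add: Forall_in_iff inst_ren_lift)
qed (simp_all add: cls_eq_iff cls_mem_iff Falsum_notin Imp_in_iff)

end

lemma henkin_set_henkin:
  assumes "finite (\<Union> (free_vars ` \<Gamma>))" "consistent \<Gamma>"
  shows "henkin_set (\<Union>n. henkin \<Gamma> n)" (is "henkin_set ?M")
proof
  show M: "consistent ?M"
  proof
    assume "?M \<turnstile> \<^bold>\<bottom>"
    then obtain \<Delta> where \<Delta>: "\<Delta> \<subseteq> ?M" "finite \<Delta>" "\<Delta> \<turnstile> \<^bold>\<bottom>"
      using provable_finite by blast
    \<comment> \<open>The stages form a chain, so a finite inconsistent subset of the union already
      lies in one consistent stage.\<close>
    have "\<exists>n. \<Delta> \<subseteq> henkin \<Gamma> n"
      using \<Delta>(2,1)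
    proof (induction \<Delta> rule: finite_induct)
      case (insert q \<Delta>)
      then obtain m n where "\<Delta> \<subseteq> henkin \<Gamma> m" "q \<in> henkin \<Gamma> n" by auto
      then have "insert q \<Delta> \<subseteq> henkin \<Gamma> (max m n)"
        using henkin_mono[of m "max m n" \<Gamma>] henkin_mono[of n "max m n" \<Gamma>] by auto
      then show ?case ..
    qed simp
    then obtain n where "\<Delta> \<subseteq> henkin \<Gamma> n" ..
    with \<Delta>(3) consistent_henkin[OF assms, of n] show False
      using weakening by blast
  qed
  \<comment> \<open>Consistency with the union implies consistency with the stage at which
    \<open>p\<close> is examined, so \<open>p\<close> is added there together with its
    witness.\<close>
  have step: "p \<in> ?M \<and> witness (henkin \<Gamma> (to_nat p)) p \<subseteq> ?M" if "consistent (insert p ?M)" for p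
  proof -
    have "consistent (insert p (henkin \<Gamma> (to_nat p)))"
      using that weakening[of "insert p (henkin \<Gamma> (to_nat p))" _ "insert p ?M"] by blast
    then have "insert p (witness (henkin \<Gamma> (to_nat p)) p) \<subseteq> henkin \<Gamma> (Suc (to_nat p))"
      by (auto simp: Let_def)
    then show ?thesis by blast
  qed
  show "p \<in> ?M" if "consistent (insert p ?M)" for p
    using step[OF that] ..
  show "\<exists>t. \<^bold>\<not>(inst t p) \<in> ?M" if "\<^bold>\<not>(\<^bold>\<forall>p) \<in> ?M" for p
  proof -
    have "consistent (insert (\<^bold>\<not>(\<^bold>\<forall>p)) ?M)"
      using M that by (simp add: insert_absorb)
    from step[OF this] show ?thesis
      unfolding witness_def by blast
  qed
qed

text \<open>If \<open>p\<close> is not derivable, the term model of a Henkin set containing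
  \<open>\<Gamma>\<close> and the negation of \<open>p\<close> satisfies \<open>\<Gamma>\<close> and
  refutes \<open>p\<close> under \<open>cls\<close>. Its elements are sets of variables, so domains
  of type \<open>nat set set\<close> suffice. Closedness of \<open>\<Gamma>\<close> leaves
  infinitely many variables fresh.\<close>

theorem completeness:
  assumes closed: "\<And>q. q \<in> \<Gamma> \<Longrightarrow> free_vars q = {}"
    and valid: "\<And>(U :: nat set set) E. U \<noteq> {} \<Longrightarrow> (\<And>q. q \<in> \<Gamma> \<Longrightarrow> valid_in U E q) \<Longrightarrow> valid_in U E p"
  shows "\<Gamma> \<turnstile> p"
proof (rule ccontr)
  assume "\<not> \<Gamma> \<turnstile> p"
  then have "consistent (insert (\<^bold>\<not>p) \<Gamma>)"
    using Contradiction by blast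
  moreover have "\<Union> (free_vars ` \<Gamma>) = {}"
    using closed by blast
  then have "finite (\<Union> (free_vars ` insert (\<^bold>\<not>p) \<Gamma>))"
    by (simp add: finite_free_vars)
  ultimately have henkin: "henkin_set (\<Union>n. henkin (insert (\<^bold>\<not>p) \<Gamma>) n)"
    by (rule henkin_set_henkin[rotated])
  define M where "M = (\<Union>n. henkin (insert (\<^bold>\<not>p) \<Gamma>) n)"
  interpret henkin_set M
    unfolding M_def by (rule henkin)
  have sub: "insert (\<^bold>\<not>p) \<Gamma> \<subseteq> M"
    unfolding M_def using henkin.simps(1) by blast
  have "valid_in (range cls) cls_mem q" if "q \<in> \<Gamma>" for q
    unfolding valid_in_def
  proof (intro allI impI)
    fix e :: "nat \<Rightarrow> nat set"
    assume "range e \<subseteq> range cls"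
    then have "\<forall>n. \<exists>t. e n = cls t"
      by blast
    then obtain r where "\<forall>n. e n = cls (r n)"
      by metis
    then have "e = (\<lambda>n. cls (r n))"
      by blast
    \<comment> \<open>Every assignment into the term model comes from a renaming \<open>r\<close>,
      and \<open>r\<close> leaves the sentence \<open>q\<close> unchanged.\<close>
    moreover have "ren r q \<in> M"
      using that sub by (auto simp: ren_closed[OF closed[OF that]])
    ultimately show "sat (range cls) cls_mem e q"
      by (simp only: sat_cls_iff)
  qed
  with valid have "valid_in (range cls) cls_mem p"
    by blast
  then have "sat (range cls) cls_mem cls p"
    unfolding valid_in_def by blast
  then have "p \<in> M"
    using sat_cls_iff[of "\<lambda>n. n" p] by (simp add: ren_ident)
  moreover have "\<^bold>\<not>p \<in> M"
    using sub by blast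
  ultimately show False
    using Neg_in_iff by blast
qed

section \<open>Models\<close>

lemma valid_in_Forall: "valid_in U E (\<^bold>\<forall>p) \<Longrightarrow> valid_in U E p"
  unfolding valid_in_def
proof (intro allI impI)
  fix e :: "nat \<Rightarrow> 'a"
  assume *: "\<forall>e. range e \<subseteq> U \<longrightarrow> sat U E e (\<^bold>\<forall>p)" and e: "range e \<subseteq> U"
  have "range (\<lambda>n. e (Suc n)) \<subseteq> U"
    using e by blast
  with * e have "sat U E (e 0 ## (\<lambda>n. e (Suc n))) p"
    by (auto simp: image_subset_iff)
  then show "sat U E e p"
    by (simp only: extend_eta)
qed

lemma valid_in_universal_closures:
  assumes "\<And>q. q \<in> universal_closures p \<Longrightarrow> valid_in U E q"
  shows "valid_in U E p"
proof -
  have "valid_in U E ((Forall ^^ n) p) \<Longrightarrow> valid_in U E p" for n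
    by (induction n) (auto dest: valid_in_Forall)
  with ex_universal_closure[of p] assms show ?thesis
    by blast
qed

lemma sat_skip_1: "sat U E (a ## b ## e) (skip (Suc 0) p) = sat U E (a ## e) p"
proof -
  have "(\<lambda>n. (a ## b ## e) (if n < Suc 0 then n else Suc n)) = a ## e"
    by (simp add: fun_eq_iff split: nat.split)
  then show ?thesis
    unfolding skip_def sat_ren by simp
qed

lemma sat_skip_2: "sat U E (a ## b ## c ## e) (skip (Suc (Suc 0)) p) = sat U E (a ## b ## e) p"
proof -
  have "(\<lambda>n. (a ## b ## c ## e) (if n < Suc (Suc 0) then n else Suc n)) = a ## b ## e"
    by (auto simp: fun_eq_iff split: nat.split)
  then show ?thesis
    unfolding skip_def sat_ren by simp
qed

lemma sat_Exists1:
  "sat U E e (\<^bold>\<exists>!p) \<longleftrightarrow> (\<exists>x\<in>U. sat U E (x ## e) p \<and> (\<forall>y\<in>U. sat U E (y ## e) p \<longrightarrow> y = x))"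
  unfolding Exists1_def One_nat_def sat.simps sat_skip_1 nat.case by blast

section \<open>The two forms of choice evaluated in a structure\<close>

lemmas eval_index = numeral_eq_Suc pred_numeral_simps BitM.simps One_nat_def add_Suc_right add_0_right nat.case

text \<open>Conjunction, disjunction and existence are coded by implication, falsum and universal
  quantification. Negation normal form removes the resulting double negations on both sides of an
  equivalence.\<close>

lemmas nnf = imp_conv_disj de_Morgan_conj de_Morgan_disj not_not ball_simps(10) bex_simps(8)
  simp_thms conj_assoc disj_assoc

lemma sat_AC:
  "sat U E e AC \<longleftrightarrow> (\<forall>x\<in>U.
    (\<forall>z\<in>U. E z x \<longrightarrow> (\<exists>b\<in>U. E b z)) \<and>
    (\<forall>z\<in>U. E z x \<longrightarrow> (\<forall>z'\<in>U. E z' x \<longrightarrow> z \<noteq> z' \<longrightarrow> \<not> (\<exists>a\<in>U. E a z \<and> E a z'))) \<longrightarrow>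
    (\<exists>y\<in>U. \<forall>z\<in>U. E z x \<longrightarrow> (\<exists>b\<in>U. E b z) \<longrightarrow>
      (\<exists>a\<in>U. E a z \<and> E a y \<and> (\<forall>b\<in>U. E b z \<and> E b y \<longrightarrow> b = a))))"
  unfolding AC_def AC_h1_def AC_h2_def Choice_set_def sat.simps eval_index by (simp only: nnf)

lemma sat_AC_ss:
  "sat U E e AC_ss \<longleftrightarrow> (\<forall>x\<in>U. \<exists>y\<in>U. \<forall>z\<in>U. \<exists>a\<in>U. \<forall>b\<in>U.
    E y x \<and> (E z y \<longrightarrow> E a x \<and> a \<noteq> y \<and> E z a) \<or>
    \<not> E y x \<and> (E z x \<longrightarrow> (E b z \<longrightarrow> E a z \<and> E a y) \<and>
      (E a z \<and> E a y \<longrightarrow> E b z \<and> E b y \<longrightarrow> b = a)))"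
  unfolding AC_ss_def AC_ss_matrix_def A_fm_def B_fm_def sat.simps eval_index by (simp only: nnf)

lemma valid_AC_ss_Imp_AC: "valid_in U E (AC_ss \<^bold>\<longrightarrow> AC)"
  unfolding valid_in_def sat.simps(4) sat_AC sat_AC_ss
proof (intro allI impI ballI, elim conjE)
  fix x
  assume AC_ss: "\<forall>x\<in>U. \<exists>y\<in>U. \<forall>z\<in>U. \<exists>a\<in>U. \<forall>b\<in>U.
      E y x \<and> (E z y \<longrightarrow> E a x \<and> a \<noteq> y \<and> E z a) \<or>
      \<not> E y x \<and> (E z x \<longrightarrow> (E b z \<longrightarrow> E a z \<and> E a y) \<and>
        (E a z \<and> E a y \<longrightarrow> E b z \<and> E b y \<longrightarrow> b = a))"
    and x: "x \<in> U"
    and nonempty: "\<forall>z\<in>U. E z x \<longrightarrow> (\<exists>b\<in>U. E b z)"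
    and disjoint: "\<forall>z\<in>U. E z x \<longrightarrow> (\<forall>z'\<in>U. E z' x \<longrightarrow> z \<noteq> z' \<longrightarrow> \<not> (\<exists>a\<in>U. E a z \<and> E a z'))"
  from AC_ss x obtain y where y: "y \<in> U" "\<forall>z\<in>U. \<exists>a\<in>U. \<forall>b\<in>U.
      E y x \<and> (E z y \<longrightarrow> E a x \<and> a \<noteq> y \<and> E z a) \<or>
      \<not> E y x \<and> (E z x \<longrightarrow> (E b z \<longrightarrow> E a z \<and> E a y) \<and>
        (E a z \<and> E a y \<longrightarrow> E b z \<and> E b y \<longrightarrow> b = a))"
    by blast
  have notin: "\<not> E y x"
  proof
    assume "E y x"
    with nonempty y(1) obtain z where z: "z \<in> U" "E z y"
      by blast
    with y(2) \<open>E y x\<close> obtain a where "a \<in> U" "E a x" "a \<noteq> y" "E z a"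
      by metis
    with disjoint y(1) z \<open>E y x\<close> show False
      by blast
  qed
  have "\<exists>a\<in>U. E a z \<and> E a y \<and> (\<forall>b\<in>U. E b z \<and> E b y \<longrightarrow> b = a)"
    if z: "z \<in> U" "E z x" for z
  proof -
    \<comment> \<open>This \<open>a\<close> is fixed before \<open>b\<close>. Taking an element of
      \<open>z\<close> for \<open>b\<close> puts \<open>a\<close> in both \<open>z\<close> and
      \<open>y\<close>; the remaining values of \<open>b\<close> then give uniqueness.\<close>
    from y(2) z(1) obtain a where "a \<in> U" and a: "\<forall>b\<in>U. (E b z \<longrightarrow> E a z \<and> E a y) \<and>
        (E a z \<and> E a y \<longrightarrow> E b z \<and> E b y \<longrightarrow> b = a)"
      using notin z(2) by blast
    moreover obtain b where "b \<in> U" "E b z"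
      using nonempty z by blast
    ultimately show ?thesis
      by blast
  qed
  with y(1) show "\<exists>y\<in>U. \<forall>z\<in>U. E z x \<longrightarrow> (\<exists>b\<in>U. E b z) \<longrightarrow>
      (\<exists>a\<in>U. E a z \<and> E a y \<and> (\<forall>b\<in>U. E b z \<and> E b y \<longrightarrow> b = a))"
    by blast
qed

text \<open>In the notation of the introduction, \<open>private_part_fm u z x\<close> expresses \<open>u = P z\<close>.\<close>

definition private_fm :: "nat \<Rightarrow> nat \<Rightarrow> nat \<Rightarrow> fm"
  where "private_fm w z x = BForall x (\<^bold>\<not>(0 \<^bold>= z + 1) \<^bold>\<longrightarrow> \<^bold>\<not>(w + 1 \<^bold>\<in> 0))"

definition private_part_fm :: "nat \<Rightarrow> nat \<Rightarrow> nat \<Rightarrow> fm"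
  where "private_part_fm u z x =
    BForall u (0 \<^bold>\<in> z + 1 \<^bold>\<and> private_fm 0 (z + 1) (x + 1)) \<^bold>\<and>
    BForall z (private_fm 0 (z + 1) (x + 1) \<^bold>\<longrightarrow> 0 \<^bold>\<in> u + 1)"

lemma bounded_Con: "bounded p \<Longrightarrow> bounded q \<Longrightarrow> bounded (p \<^bold>\<and> q)"
  by (intro bounded.intros)

lemma bounded_private_fm: "bounded (private_fm w z x)"
  unfolding private_fm_def by (intro bounded.intros)

text \<open>Boundedness is the reason for writing the equality as two inclusions: each quantifies
  over the elements of one given set, whereas a biconditional for all \<open>w\<close> would be
  unbounded.\<close>

lemma bounded_private_part_fm: "bounded (private_part_fm u z x)"
  unfolding private_part_fm_def by (intro bounded_Con bounded.intros(1,4,5) bounded_private_fm)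

section \<open>Constructions in a model of the set axioms\<close>

locale set_model =
  fixes U :: "'a set" and E :: "'a \<Rightarrow> 'a \<Rightarrow> bool"
  assumes nonempty: "U \<noteq> {}"
    and axioms: "q \<in> set_axioms \<Longrightarrow> valid_in U E q"
begin

lemma ex_assignment: "\<exists>e :: nat \<Rightarrow> 'a. range e \<subseteq> U"
  using nonempty by (auto intro: exI[of _ "\<lambda>_. SOME x. x \<in> U"] simp: some_in_eq)

lemma extensionality:
  assumes "x \<in> U" "y \<in> U" "\<And>z. z \<in> U \<Longrightarrow> E z x \<longleftrightarrow> E z y"
  shows "x = y"
proof -
  obtain e :: "nat \<Rightarrow> 'a" where "range e \<subseteq> U"
    using ex_assignment ..
  moreover have "valid_in U E Extensionality"
    by (rule axioms) (simp add: set_axioms_def)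
  ultimately have "sat U E e Extensionality"
    unfolding valid_in_def by blast
  then have "\<forall>x\<in>U. \<forall>y\<in>U. (\<forall>z\<in>U. E z x \<longleftrightarrow> E z y) \<longrightarrow> x = y"
    unfolding Extensionality_def sat.simps eval_index iff_conv_conj_imp by (simp only: nnf)
  with assms show ?thesis
    by blast
qed

lemma pairing:
  assumes "x \<in> U" "y \<in> U"
  obtains z where "z \<in> U" "\<And>a. a \<in> U \<Longrightarrow> E a z \<longleftrightarrow> a = x \<or> a = y"
proof -
  obtain e :: "nat \<Rightarrow> 'a" where "range e \<subseteq> U"
    using ex_assignment ..
  moreover have "valid_in U E Pairing"
    by (rule axioms) (simp add: set_axioms_def)
  ultimately have "sat U E e Pairing"
    unfolding valid_in_def by blast
  then have "\<forall>x\<in>U. \<forall>y\<in>U. \<exists>z\<in>U. \<forall>a\<in>U. E a z \<longleftrightarrow> a = x \<or> a = y"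
    unfolding Pairing_def sat.simps eval_index iff_conv_conj_imp by (simp only: nnf)
  from bspec[OF bspec[OF this assms(1)] assms(2)]
  obtain z where "z \<in> U" "\<forall>a\<in>U. E a z \<longleftrightarrow> a = x \<or> a = y" ..
  from this(1) bspec[OF this(2)] show ?thesis
    by (rule that)
qed

text \<open>The axioms contain only closed instances; stripping the closure turns the parameters of
  \<open>p\<close> into the values of \<open>e\<close>.\<close>

lemma separation:
  assumes "bounded p" "range e \<subseteq> U" "x \<in> U"
  obtains y where "y \<in> U" "\<And>z. z \<in> U \<Longrightarrow> E z y \<longleftrightarrow> E z x \<and> sat U E (z ## x ## e) p"
proof -
  have "valid_in U E (Separation p)"
    by (rule valid_in_universal_closures, rule axioms)
      (use assms(1) in \<open>auto simp: set_axioms_def\<close>)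
  with assms(2) have "sat U E e (Separation p)"
    unfolding valid_in_def by blast
  then have "\<forall>x\<in>U. \<exists>y\<in>U. \<forall>z\<in>U. E z y \<longleftrightarrow> E z x \<and> sat U E (z ## x ## e) p"
    unfolding Separation_def sat.simps eval_index sat_skip_1 iff_conv_conj_imp by (simp only: nnf)
  with assms(3) that show ?thesis
    by blast
qed

lemma replacement:
  assumes "bounded p" "range e \<subseteq> U" "x \<in> U"
    and "\<And>z. z \<in> U \<Longrightarrow> \<exists>u\<in>U. sat U E (u ## z ## x ## e) p \<and>
      (\<forall>v\<in>U. sat U E (v ## z ## x ## e) p \<longrightarrow> v = u)"
  obtains y where "y \<in> U"
    "\<And>z. z \<in> U \<Longrightarrow> E z x \<Longrightarrow> \<exists>u\<in>U. E u y \<and> sat U E (u ## z ## x ## e) p"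
proof -
  have "valid_in U E (Replacement p)"
    by (rule valid_in_universal_closures, rule axioms)
      (use assms(1) in \<open>auto simp: set_axioms_def\<close>)
  with assms(2) have "sat U E e (Replacement p)"
    unfolding valid_in_def by blast
  then have "\<forall>x\<in>U. (\<forall>z\<in>U. \<exists>u\<in>U. sat U E (u ## z ## x ## e) p \<and>
      (\<forall>v\<in>U. sat U E (v ## z ## x ## e) p \<longrightarrow> v = u)) \<longrightarrow>
      (\<exists>y\<in>U. \<forall>z\<in>U. E z x \<longrightarrow> (\<exists>u\<in>U. E u y \<and> sat U E (u ## z ## x ## e) p))"
    unfolding Replacement_def sat.simps sat_Exists1 sat_skip_2 eval_index by (simp only: nnf)
  note bspec[OF this assms(3)]
  moreover have "\<forall>z\<in>U. \<exists>u\<in>U. sat U E (u ## z ## x ## e) p \<and>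
      (\<forall>v\<in>U. sat U E (v ## z ## x ## e) p \<longrightarrow> v = u)"
    using assms(4) ..
  ultimately have "\<exists>y\<in>U. \<forall>z\<in>U. E z x \<longrightarrow> (\<exists>u\<in>U. E u y \<and> sat U E (u ## z ## x ## e) p)"
    by (rule mp)
  with that show ?thesis
    by blast
qed

definition private_to :: "'a \<Rightarrow> 'a \<Rightarrow> 'a \<Rightarrow> bool"
  where "private_to w z x \<longleftrightarrow> (\<forall>z'\<in>U. E z' x \<longrightarrow> z' \<noteq> z \<longrightarrow> \<not> E w z')"

lemma sat_private_fm: "sat U E e (private_fm w z x) \<longleftrightarrow> private_to (e w) (e z) (e x)"
  by (simp add: private_fm_def private_to_def)

lemma sat_private_part_fm:
  "sat U E e (private_part_fm u z x) \<longleftrightarrow>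
    (\<forall>w\<in>U. E w (e u) \<longleftrightarrow> E w (e z) \<and> private_to w (e z) (e x))"
  by (simp add: private_part_fm_def sat_private_fm) blast

text \<open>\<open>P\<close> is a function of the metatheory, chosen by \<open>bchoice\<close>
  merely to name the sets that Separation provides. No choice inside the model is involved.\<close>

lemma private_part:
  assumes "x \<in> U"
  obtains P where "\<And>z. z \<in> U \<Longrightarrow> P z \<in> U"
    "\<And>z w. z \<in> U \<Longrightarrow> w \<in> U \<Longrightarrow> E w (P z) \<longleftrightarrow> E w z \<and> private_to w z x"
proof -
  obtain e :: "nat \<Rightarrow> 'a" where e: "range e \<subseteq> U"
    using ex_assignment ..
  have "\<exists>u\<in>U. \<forall>w\<in>U. E w u \<longleftrightarrow> E w z \<and> private_to w z x" if "z \<in> U" for z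
  proof -
    have "range (x ## e) \<subseteq> U"
      using e assms by (simp add: range_extend)
    then obtain u where "u \<in> U"
      "\<And>w. w \<in> U \<Longrightarrow> E w u \<longleftrightarrow> E w z \<and> sat U E (w ## z ## x ## e) (private_fm 0 1 2)"
      using separation[OF bounded_private_fm _ \<open>z \<in> U\<close>] by metis
    then show ?thesis
      by (auto simp: sat_private_fm numeral_eq_Suc)
  qed
  then have "\<exists>P. \<forall>z\<in>U. P z \<in> U \<and> (\<forall>w\<in>U. E w (P z) \<longleftrightarrow> E w z \<and> private_to w z x)"
    by (intro bchoice) blast
  with that show ?thesis
    by blast
qed

text \<open>Replacement yields only a set \<open>Y\<close> containing all \<open>P z\<close> with
  \<open>z\<close> in \<open>x\<close>; Separation then cuts it down to exactly these. Since
  Replacement asks for unique values at every \<open>z\<close> of the model, \<open>P\<close> is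
  total on \<open>U\<close>.\<close>

lemma private_part_image:
  assumes "x \<in> U" and P: "\<And>z. z \<in> U \<Longrightarrow> P z \<in> U"
    "\<And>z w. z \<in> U \<Longrightarrow> w \<in> U \<Longrightarrow> E w (P z) \<longleftrightarrow> E w z \<and> private_to w z x"
  obtains X where "X \<in> U" "\<And>u. u \<in> U \<Longrightarrow> E u X \<longleftrightarrow> (\<exists>z\<in>U. E z x \<and> u = P z)"
proof -
  obtain e :: "nat \<Rightarrow> 'a" where e: "range e \<subseteq> U"
    using ex_assignment ..
  have eq_P: "(\<forall>w\<in>U. E w u \<longleftrightarrow> E w z \<and> private_to w z x) \<longleftrightarrow> u = P z"
    if "u \<in> U" "z \<in> U" for u z
    using that P by (blast intro: extensionality)
  have sat: "sat U E (u ## z ## x ## e) (private_part_fm 0 1 2) \<longleftrightarrow> u = P z"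
    if "u \<in> U" "z \<in> U" for u z
    using eq_P[OF that] by (simp add: sat_private_part_fm numeral_eq_Suc)
  have "\<exists>u\<in>U. sat U E (u ## z ## x ## e) (private_part_fm 0 1 2) \<and>
      (\<forall>v\<in>U. sat U E (v ## z ## x ## e) (private_part_fm 0 1 2) \<longrightarrow> v = u)" if "z \<in> U" for z
    using that P(1) sat by blast
  from replacement[OF bounded_private_part_fm e \<open>x \<in> U\<close> this]
  obtain Y where Y: "Y \<in> U" "\<And>z. z \<in> U \<Longrightarrow> E z x \<Longrightarrow>
      \<exists>u\<in>U. E u Y \<and> sat U E (u ## z ## x ## e) (private_part_fm 0 1 2)"
    by blast
  have "range (x ## e) \<subseteq> U"
    using e assms(1) by (simp add: range_extend)
  \<comment> \<open>Outside, the indices 0, 1, 2 are \<open>u\<close>, \<open>Y\<close>,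
    \<open>x\<close>; under the quantifier \<open>z\<close> is 0, so \<open>u\<close> is 1 and
    \<open>x\<close> is 3.\<close>
  moreover have "bounded (BExists 2 (private_part_fm 1 0 3))"
    by (rule bounded.intros(6)) (rule bounded_private_part_fm)
  ultimately obtain X where X: "X \<in> U" "\<And>u. u \<in> U \<Longrightarrow> E u X \<longleftrightarrow> E u Y \<and>
      sat U E (u ## Y ## x ## e) (BExists 2 (private_part_fm 1 0 3))"
    using separation[OF _ _ Y(1)] by metis
  have "E u X \<longleftrightarrow> (\<exists>z\<in>U. E z x \<and> u = P z)" if "u \<in> U" for u
  proof -
    have "E u X \<longleftrightarrow> E u Y \<and> (\<exists>z\<in>U. E z x \<and> u = P z)"
      using X(2)[OF that] eq_P[OF that] by (auto simp: sat_private_part_fm numeral_eq_Suc)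
    then show ?thesis
      using Y(2) sat by blast
  qed
  with X(1) that show ?thesis
    by blast
qed

text \<open>The empty set and its singleton are distinct, so one of them differs from
  \<open>c\<close>.\<close>

lemma ex_other:
  assumes "c \<in> U"
  obtains d where "d \<in> U" "d \<noteq> c"
proof -
  obtain e :: "nat \<Rightarrow> 'a" where "range e \<subseteq> U"
    using ex_assignment ..
  then obtain u where u: "u \<in> U" "\<And>a. a \<in> U \<Longrightarrow> \<not> E a u"
    using separation[OF bounded.intros(3) _ assms] by (metis sat.simps(3))
  obtain s where "s \<in> U" "E u s"
    using pairing[OF u(1) u(1)] u(1) by metis
  with u that show ?thesis
    by metis
qed

lemma choice_for_private_parts:
  assumes AC: "valid_in U E AC" and "x \<in> U"
    and ex_private: "\<And>z. z \<in> U \<Longrightarrow> E z x \<Longrightarrow> \<exists>w\<in>U. E w z \<and> private_to w z x"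
  shows "\<exists>y\<in>U. \<forall>z\<in>U. E z x \<longrightarrow>
    (\<exists>c\<in>U. E c z \<and> E c y \<and> private_to c z x \<and> (\<forall>b\<in>U. E b z \<and> E b y \<longrightarrow> b = c))"
proof -
  obtain e :: "nat \<Rightarrow> 'a" where e: "range e \<subseteq> U"
    using ex_assignment ..
  obtain P where P: "\<And>z. z \<in> U \<Longrightarrow> P z \<in> U"
    "\<And>z w. z \<in> U \<Longrightarrow> w \<in> U \<Longrightarrow> E w (P z) \<longleftrightarrow> E w z \<and> private_to w z x"
    using private_part[OF \<open>x \<in> U\<close>] by blast
  obtain X where X: "X \<in> U" "\<And>u. u \<in> U \<Longrightarrow> E u X \<longleftrightarrow> (\<exists>z\<in>U. E z x \<and> u = P z)"
    using private_part_image[OF \<open>x \<in> U\<close> P] by blast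
  have nonempty: "\<forall>u\<in>U. E u X \<longrightarrow> (\<exists>b\<in>U. E b u)"
    using X(2) P ex_private by metis
  have "z = z'" if "z \<in> U" "E z x" "z' \<in> U" "E z' x" "a \<in> U" "E a (P z)" "E a z'" for z z' a
    using that P(2)[of z a] unfolding private_to_def by blast
  note same = this
  have disjoint: "\<forall>u\<in>U. E u X \<longrightarrow> (\<forall>u'\<in>U. E u' X \<longrightarrow> u \<noteq> u' \<longrightarrow> \<not> (\<exists>a\<in>U. E a u \<and> E a u'))"
    using X(2) P(2) same by metis
  have "sat U E e AC"
    using AC e unfolding valid_in_def by blast
  with nonempty disjoint X(1) obtain C where C: "C \<in> U" "\<forall>u\<in>U. E u X \<longrightarrow> (\<exists>b\<in>U. E b u) \<longrightarrow>
      (\<exists>a\<in>U. E a u \<and> E a C \<and> (\<forall>b\<in>U. E b u \<and> E b C \<longrightarrow> b = a))"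
    unfolding sat_AC by blast
  have "range (X ## e) \<subseteq> U"
    using e X(1) by (simp add: range_extend)
  \<comment> \<open>This formula says that \<open>c\<close> lies in some element of
    \<open>X\<close>. Without the restriction, the choice-set could contain further, non-private
    points of members of \<open>x\<close>.\<close>
  moreover have "bounded (BExists 2 (1 \<^bold>\<in> 0))"
    by (rule bounded.intros(6)) (rule bounded.intros(1))
  ultimately obtain y where y: "y \<in> U" "\<And>c. c \<in> U \<Longrightarrow> E c y \<longleftrightarrow> E c C \<and>
      sat U E (c ## C ## X ## e) (BExists 2 (1 \<^bold>\<in> 0))"
    using separation[OF _ _ C(1)] by metis
  have y_iff: "E c y \<longleftrightarrow> E c C \<and> (\<exists>z\<in>U. E z x \<and> E c (P z))" if "c \<in> U" for c
  proof -
    have "E c y \<longleftrightarrow> E c C \<and> (\<exists>u\<in>U. E u X \<and> E c u)"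
      using y(2)[OF that] by (simp add: numeral_eq_Suc)
    then show ?thesis
      using X(2) P(1) by metis
  qed
  have "\<exists>c\<in>U. E c z \<and> E c y \<and> private_to c z x \<and> (\<forall>b\<in>U. E b z \<and> E b y \<longrightarrow> b = c)"
    if z: "z \<in> U" "E z x" for z
  proof -
    have "E (P z) X"
      using X(2) P(1) z by blast
    with C(2) nonempty P(1)[OF z(1)] obtain c where c: "c \<in> U" "E c (P z)" "E c C"
      "\<forall>b\<in>U. E b (P z) \<and> E b C \<longrightarrow> b = c"
      by blast
    have "b = c" if b: "b \<in> U" "E b z" "E b y" for b
    proof -
      \<comment> \<open>Being in \<open>y\<close>, the point \<open>b\<close> is private to some
        \<open>z'\<close> in \<open>x\<close>. As \<open>b\<close> also lies in \<open>z\<close>,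
        privacy forces \<open>z' = z\<close>, so \<open>b\<close> is the point chosen from
        \<open>P z\<close>.\<close>
      obtain z' where "z' \<in> U" "E z' x" "E b (P z')" "E b C"
        using y_iff b by blast
      with same z b have "E b (P z)"
        by blast
      with c(4) b(1) \<open>E b C\<close> show ?thesis
        by blast
    qed
    with c y_iff P(2) z show ?thesis
      by blast
  qed
  with y(1) show ?thesis
    by blast
qed

lemma valid_AC_Imp_AC_ss:
  assumes "valid_in U E AC"
  shows "valid_in U E AC_ss"
  unfolding valid_in_def sat_AC_ss
proof (intro allI impI ballI)
  fix x
  assume x: "x \<in> U"
  let ?A = "\<lambda>y z a. E z y \<longrightarrow> E a x \<and> a \<noteq> y \<and> E z a"
  let ?B = "\<lambda>y z a b. (E b z \<longrightarrow> E a z \<and> E a y) \<and> (E a z \<and> E a y \<longrightarrow> E b z \<and> E b y \<longrightarrow> b = a)"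
  let ?goal = "\<exists>y\<in>U. \<forall>z\<in>U. \<exists>a\<in>U. \<forall>b\<in>U.
    E y x \<and> ?A y z a \<or> \<not> E y x \<and> (E z x \<longrightarrow> ?B y z a b)"
  \<comment> \<open>\<open>A\<close> and \<open>B\<close> reduce the goal to one disjunct each,
    according to whether \<open>y\<close> is in \<open>x\<close>. For a \<open>z\<close> outside
    \<open>y\<close> or \<open>x\<close>, respectively, the implication is vacuous and any
    \<open>a\<close> will do.\<close>
  have A: ?goal if y: "y \<in> U" "E y x" and *: "\<And>z. z \<in> U \<Longrightarrow> E z y \<Longrightarrow> \<exists>a\<in>U. ?A y z a" for y
  proof (rule bexI[OF _ y(1)], rule ballI)
    fix z
    assume z: "z \<in> U"
    obtain a where "a \<in> U" "?A y z a"
      using z *[OF z] by (cases "E z y") auto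
    with y(2) show "\<exists>a\<in>U. \<forall>b\<in>U. E y x \<and> ?A y z a \<or> \<not> E y x \<and> (E z x \<longrightarrow> ?B y z a b)"
      by blast
  qed
  have B: ?goal if y: "y \<in> U" "\<not> E y x"
    and *: "\<And>z. z \<in> U \<Longrightarrow> E z x \<Longrightarrow> \<exists>a\<in>U. E a z \<and> E a y \<and> (\<forall>b\<in>U. E b z \<and> E b y \<longrightarrow> b = a)" for y
  proof (rule bexI[OF _ y(1)], rule ballI)
    fix z
    assume z: "z \<in> U"
    obtain a where "a \<in> U" "E z x \<Longrightarrow> E a z \<and> E a y \<and> (\<forall>b\<in>U. E b z \<and> E b y \<longrightarrow> b = a)"
      using z *[OF z] by (cases "E z x") auto
    with y(2) show "\<exists>a\<in>U. \<forall>b\<in>U. E y x \<and> ?A y z a \<or> \<not> E y x \<and> (E z x \<longrightarrow> ?B y z a b)"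
      by blast
  qed
  show ?goal
  proof (cases "\<exists>y\<in>U. E y x \<and> (\<forall>z\<in>U. E z y \<longrightarrow> \<not> private_to z y x)")
    case True
    then obtain y where "y \<in> U" "E y x" and y: "\<forall>z\<in>U. E z y \<longrightarrow> \<not> private_to z y x"
      by blast
    show ?thesis
      \<comment> \<open>That \<open>z\<close> is not private to \<open>y\<close> means precisely
        that another member of \<open>x\<close> contains it; this member is
        \<open>a\<close>.\<close>
      by (rule A[OF \<open>y \<in> U\<close> \<open>E y x\<close>]) (use y in \<open>unfold private_to_def, blast\<close>)
  next
    case False
    then have nonempty: "\<exists>w\<in>U. E w z \<and> private_to w z x" if "z \<in> U" "E z x" for z
      using that by blast
    obtain y where "y \<in> U" and "\<forall>z\<in>U. E z x \<longrightarrow>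
        (\<exists>c\<in>U. E c z \<and> E c y \<and> private_to c z x \<and> (\<forall>b\<in>U. E b z \<and> E b y \<longrightarrow> b = c))"
      using choice_for_private_parts[OF assms x nonempty] ..
    note y = this(2)[rule_format]
    show ?thesis
    proof (cases "E y x")
      case False
      show ?thesis
        by (rule B[OF \<open>y \<in> U\<close> False]) (use y in blast)
    next
      case True
      from y[OF \<open>y \<in> U\<close> True] obtain c where c: "c \<in> U" "E c y" "private_to c y x"
        and c_only: "\<And>b. b \<in> U \<Longrightarrow> E b y \<Longrightarrow> b = c"
        by blast
      \<comment> \<open>\<open>y\<close> has \<open>c\<close> as its only element, so every member
        of \<open>x\<close>, which must meet \<open>y\<close>, contains \<open>c\<close>; as
        \<open>c\<close> is private to \<open>y\<close>, that member is \<open>y\<close>.\<close>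
      have x_only: "E c z \<and> z = y" if z: "z \<in> U" "E z x" for z
      proof -
        from y[OF z] obtain c' where "c' \<in> U" "E c' z" "E c' y"
          by blast
        with c_only[of c'] have "E c z"
          by simp
        with c(3) z show ?thesis
          unfolding private_to_def by blast
      qed
      obtain d where d: "d \<in> U" "d \<noteq> c"
        using ex_other[OF c(1)] .
      obtain y' where y': "y' \<in> U" "\<And>a. a \<in> U \<Longrightarrow> E a y' \<longleftrightarrow> a = c \<or> a = d"
        using pairing[OF c(1) d(1)] by blast
      have "\<not> E y' x"
      proof
        assume "E y' x"
        then have "y' = y"
          using x_only y'(1) by simp
        with y'(2)[OF d(1)] c_only[OF d(1)] d(2) show False
          by simp
      qed
      with y'(1) show ?thesis
      \<comment> \<open>The only member of \<open>x\<close> is \<open>y\<close>, and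
        \<open>y'\<close> meets it in \<open>c\<close> alone because \<open>d\<close> is not in
        \<open>y\<close>.\<close>
      proof (rule B)
        fix z
        assume "z \<in> U" "E z x"
        then have "E c z" "z = y"
          using x_only by simp_all
        moreover have "E c y'"
          using y'(2) c(1) by simp
        ultimately show "\<exists>a\<in>U. E a z \<and> E a y' \<and> (\<forall>b\<in>U. E b z \<and> E b y' \<longrightarrow> b = a)"
          using c(1) c_only by blast
      qed
    qed
  qed
qed

end

theorem corollary4p2:
  shows "{} \<turnstile> (AC_ss \<^bold>\<longrightarrow> AC) \<and> set_axioms \<turnstile> (AC \<^bold>\<longrightarrow> AC_ss)"
proof
  show "{} \<turnstile> (AC_ss \<^bold>\<longrightarrow> AC)"
    by (rule completeness) (simp_all only: empty_iff valid_AC_ss_Imp_AC)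
  show "set_axioms \<turnstile> (AC \<^bold>\<longrightarrow> AC_ss)"
  \<comment> \<open>\<open>AC\<close> may join the assumptions because it is a sentence, as
    \<open>completeness\<close> demands.\<close>
  proof (rule ImpI, rule completeness)
    show "free_vars q = {}" if "q \<in> insert AC set_axioms" for q
      using that closed_set_axioms closed_AC by blast
    show "valid_in U E AC_ss"
      if "U \<noteq> {}" "\<And>q. q \<in> insert AC set_axioms \<Longrightarrow> valid_in U E q" for U :: "nat set set" and E
    proof -
      interpret set_model U E
        using that by unfold_locales auto
      show ?thesis
        using that by (intro valid_AC_Imp_AC_ss) auto
    qed
  qed
qed

end
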